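(* Assume: (1) $p_\theta\in\mathcal P(t,\zeta,D)$ for all $\theta\in\Theta$, $\inf_{\Omega\times\Theta}p(x,\theta)>\zeta$, and $\sup_{\theta\in\Theta}\|p_\theta\|_{t,2}<D$; (2) there are a constant $0<\gamma\le1$ and a measurable $R:V\to(0,\infty)$ with $\int_VR^a\,d\mu<\infty$ for some $a>0$ such that $|\rho(v,\theta')-\rho(v,\theta)|\le R(v)\|\theta'-\theta\|^\gamma$ for all $v\in V$, $\theta,\theta'\in\Theta$. Let $\mathcal F$ be a non-empty bounded subset of $\mathsf W_2^s(\Omega)$ for some $s>1/2$, and let $\mathbb G$ be the Gaussian limit process on $\Theta\times\mathcal F$ described in the context. Then, for every $\theta\in\Theta$, $\mathbb G(\theta)=\mathbb G(\theta,\cdot)$ is a measurable mapping with values in $\ell^\infty(\mathcal F)$ that has separable range. Furthermore, $$\lim_{k\to\infty}\sup_{\theta\in\Theta}\beta_{\ell^\infty(\mathcal F)}\left(\sqrt k\int_\Omega(\tilde p_k(\theta)-p_\theta)(\cdot)\,d\lambda,\ \mathbb G(\theta)(\cdot)\right)=0,$$ where the first argument denotes the process $f\mapsto\sqrt k\int_\Omega(\tilde p_k(\theta)-p_\theta)f\,d\lambda$, $f\in\mathcal F$. In fact, $\mathbb G(\theta)$ is a $P_\theta$-Brownian bridge, where $P_\theta$ denotes the probability measure with density $p_\theta$.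
   Context: $\Omega\subseteq\mathbb R$ is a non-empty bounded open interval with Borel $\sigma$-field $\mathcal B(\Omega)$ and Lebesgue measure $\lambda$. $\|f\|_2=(\int_\Omega f^2d\lambda)^{1/2}$, and $\mathcal L^2(\Omega)$ is the set of Borel functions with $\|f\|_2<\infty$. For real $s\ge0$ and $f\in\mathcal L^2(\Omega)$ with weak derivatives $f^{(\alpha)}$, $\|f\|_{s,2}^2=\sum_{0\le\alpha\le\lfloor s\rfloor}\|f^{(\alpha)}\|_2^2$ if $s$ is an integer, and for non-integer $s$ the term $\int_\Omega\int_\Omega\frac{(f^{(\lfloor s\rfloor)}(x)-f^{(\lfloor s\rfloor)}(y))^2}{|x-y|^{1+2(s-\lfloor s\rfloor)}}d\lambda(x)d\lambda(y)$ is added. For $s>1/2$, $\mathsf W_2^s(\Omega)$ is the Hilbert space of bounded continuous $f:\Omega\to\mathbb R$ with $\|f\|_{s,2}<\infty$. Let $\mathcal P(t,\zeta,D)=\{p\in\mathsf W_2^t(\Omega):\int_\Omega p\,d\lambda=1,\ \inf_\Omega p\ge\zeta,\ \|p\|_{t,2}\le D\}$, with fixed numbers $t>1/2$ and $0\le\zeta<\lambda(\Omega)^{-1}<D^2<\infty$. Set-up: $\Theta\subseteq\mathbb R^m$ is non-empty and compact and $\{p_\theta:\theta\in\Theta\}$ is a family of probability density functions on $\Omega$; $p(x,\theta)=p_\theta(x)$. $(V,\mathcal V,\mu)$ is a probability space and $\rho:V\times\Theta\to\Omega$ is measurable in its first argument and such that for every $\theta\in\Theta$ the law of $\rho(\cdot,\theta)$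 under $\mu$ has density $p_\theta$. $V_1,V_2,\dots$ are i.i.d. with law $\mu$, given by the coordinate projections on the product space $V^{\mathbb N}$. NPML-estimator: $\tilde p_k(\theta)$ is the unique maximizer over $p\in\mathcal P(t,\zeta,D)$ of $L_k(\theta,p)=k^{-1}\sum_{i=1}^k\log p(\rho(V_i,\theta))$, with $\log0=-\infty$ (existence and uniqueness hold). $\ell^\infty(\Lambda)$ is the Banach space of bounded real functions on $\Lambda$ with the sup-norm. Weak convergence of (possibly non-measurable) $Y_k$ to a Borel measurable $Y$ means that the outer integrals of $g(Y_k)$ converge to the expectation of $g(Y)$ for all bounded continuous real $g$. The process $\mathbb G$: under the hypotheses, $(\theta,f)\mapsto\sqrt k\int_\Omega(\tilde p_k(\theta)-p_\theta)f\,d\lambda$ converges weakly in $\ell^\infty(\Theta\times\mathcal F)$ to a zero-mean Gaussian process $\mathbb G$ indexed by $\Theta\times\mathcal F$, which is measurable as a mapping into $\ell^\infty(\Theta\times\mathcal F)$, has separable range, has sample paths uniformly continuous with respect to the pseudo-metric $(\operatorname{Var}[\mathbb G(\theta,f)-\mathbb G(\theta',g)])^{1/2}$, and has covariance $\operatorname{Cov}[\mathbb G(\theta,f),\mathbb G(\theta',g)]=\int_V(f(\rho(\cdot,\theta))-\int_Vf(\rho(\cdot,\theta))d\mu)(g(\rho(\cdot,\theta'))-\int_Vg(\rho(\cdot,\theta'))d\mu)d\mu$. Such a $\mathbb G$ exists and is fixed. For a metric space $(S,d)$ and mappings $Y_1:\Lambda_1\to S$, $Y_2:\Lambda_2\to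 S$ defined on probability spaces $(\Lambda_i,\mathcal A_i,P_i)$, with $Y_2$ Borel measurable with separable range, $\beta_{(S,d)}(Y_1,Y_2)=\sup\{|\int^*h(Y_1)dP_1-\int h(Y_2)dP_2|:\|h\|_{BL(S,d)}\le1\}$, where $\int^*$ is the outer integral and $\|h\|_{BL(S,d)}=\sup_S|h|+\sup_{x\ne y}|h(x)-h(y)|/d(x,y)$ for $h:S\to\mathbb R$. For a probability measure $P$, a $P$-Brownian bridge indexed by a class $\mathcal F$ is a mean-zero Gaussian process, measurable as a mapping into $\ell^\infty(\mathcal F)$, with covariance $\int fg\,dP-\int f\,dP\int g\,dP$ and with sample paths uniformly continuous with respect to the standard-deviation pseudo-metric of its increments. *)

theory Defs
  imports "HOL-Probability.Probability"
begin

section \<open>Sobolev spaces on an open interval\<close>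

text \<open>
  Functions on \<open>\<Omega>\<close> are represented as elements of \<open>extensional \<Omega>\<close> wherever they are compared or
  collected in function classes, so that equality is equality on \<open>\<Omega>\<close>.
\<close>

abbreviation lborel_on :: "real set \<Rightarrow> real measure" where
  "lborel_on \<Omega> \<equiv> restrict_space lborel \<Omega>"

definition test_function :: "real set \<Rightarrow> (real \<Rightarrow> real) \<Rightarrow> bool" where
  "test_function \<Omega> \<phi> \<longleftrightarrow>
     (\<forall>n. ((deriv ^^ n) \<phi>) differentiable_on UNIV) \<and>
     (\<exists>K. compact K \<and> K \<subseteq> \<Omega> \<and> (\<forall>x. x \<notin> K \<longrightarrow> \<phi> x = 0))"

definition locally_integrable_on :: "real set \<Rightarrow> (real \<Rightarrow> real) \<Rightarrow> bool" where
  "locally_integrable_on \<Omega> f \<longleftrightarrow>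
     f \<in> borel_measurable (lborel_on \<Omega>) \<and>
     (\<forall>K. compact K \<and> K \<subseteq> \<Omega> \<longrightarrow> set_integrable lborel K f)"

definition has_weak_deriv :: "real set \<Rightarrow> nat \<Rightarrow> (real \<Rightarrow> real) \<Rightarrow> (real \<Rightarrow> real) \<Rightarrow> bool" where
  "has_weak_deriv \<Omega> \<alpha> f g \<longleftrightarrow>
     locally_integrable_on \<Omega> f \<and> locally_integrable_on \<Omega> g \<and>
     (\<forall>\<phi>. test_function \<Omega> \<phi> \<longrightarrow>
        (\<integral>x. f x * (deriv ^^ \<alpha>) \<phi> x \<partial>lborel_on \<Omega>) =
        (-1) ^ \<alpha> * (\<integral>x. g x * \<phi> x \<partial>lborel_on \<Omega>))"

text \<open>Weak derivatives are unique almost everywhere, so the version chosen here does not affect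
  the norm below.\<close>

definition weak_deriv :: "real set \<Rightarrow> nat \<Rightarrow> (real \<Rightarrow> real) \<Rightarrow> real \<Rightarrow> real" where
  "weak_deriv \<Omega> \<alpha> f = (SOME g. has_weak_deriv \<Omega> \<alpha> f g)"

text \<open>The extended square of the Sobolev norm. It is infinite if some weak derivative of order up to
  \<open>\<lfloor>s\<rfloor>\<close> does not exist. On the diagonal the integrand of the double integral is \<open>0\<close>, by the
  convention \<open>x / 0 = 0\<close>; the diagonal is a null set.\<close>

definition sobolev_sqnorm :: "real set \<Rightarrow> real \<Rightarrow> (real \<Rightarrow> real) \<Rightarrow> ennreal" where
  "sobolev_sqnorm \<Omega> s f =
     (if \<forall>\<alpha>\<le>nat \<lfloor>s\<rfloor>. \<exists>g. has_weak_deriv \<Omega> \<alpha> f g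
      then (\<Sum>\<alpha>\<le>nat \<lfloor>s\<rfloor>. \<integral>\<^sup>+x. ennreal ((weak_deriv \<Omega> \<alpha> f x)\<^sup>2) \<partial>lborel_on \<Omega>) +
        (if s \<in> \<int> then 0
         else \<integral>\<^sup>+y. (\<integral>\<^sup>+x. ennreal
                ((weak_deriv \<Omega> (nat \<lfloor>s\<rfloor>) f x - weak_deriv \<Omega> (nat \<lfloor>s\<rfloor>) f y)\<^sup>2 /
                 \<bar>x - y\<bar> powr (1 + 2 * (s - of_int \<lfloor>s\<rfloor>))) \<partial>lborel_on \<Omega>) \<partial>lborel_on \<Omega>)
      else \<top>)"

text \<open>The real-valued norm is meaningful only for functions with finite \<open>sobolev_sqnorm\<close>.\<close>

definition sobolev_norm :: "real set \<Rightarrow> real \<Rightarrow> (real \<Rightarrow> real) \<Rightarrow> real" where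
  "sobolev_norm \<Omega> s f = sqrt (enn2real (sobolev_sqnorm \<Omega> s f))"

definition sobolev_space :: "real set \<Rightarrow> real \<Rightarrow> (real \<Rightarrow> real) set" where
  "sobolev_space \<Omega> s =
     {f \<in> extensional \<Omega>. continuous_on \<Omega> f \<and> bounded (f ` \<Omega>) \<and> sobolev_sqnorm \<Omega> s f < \<top>}"

definition sobolev_densities :: "real set \<Rightarrow> real \<Rightarrow> real \<Rightarrow> real \<Rightarrow> (real \<Rightarrow> real) set" where
  "sobolev_densities \<Omega> t \<zeta> D =
     {p \<in> sobolev_space \<Omega> t. (\<integral>x. p x \<partial>lborel_on \<Omega>) = 1 \<and>
        (INF x\<in>\<Omega>. p x) \<ge> \<zeta> \<and> sobolev_norm \<Omega> t p \<le> D}"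


section \<open>The nonparametric maximum likelihood estimator\<close>

definition ext_ln :: "real \<Rightarrow> ereal" where
  "ext_ln x = (if 0 < x then ereal (ln x) else - \<infinity>)"

text \<open>A sample is a sequence \<open>\<omega>\<close> whose entries \<open>\<omega> 0, \<dots>, \<omega> (k - 1)\<close> are the first \<open>k\<close> observations
  \<open>V\<^sub>1, \<dots>, V\<^sub>k\<close>.\<close>

definition mean_log_likelihood ::
  "('v \<Rightarrow> 'c \<Rightarrow> real) \<Rightarrow> nat \<Rightarrow> (nat \<Rightarrow> 'v) \<Rightarrow> 'c \<Rightarrow> (real \<Rightarrow> real) \<Rightarrow> ereal" where
  "mean_log_likelihood \<rho> k \<omega> \<theta> p = ereal (1 / real k) * (\<Sum>i<k. ext_ln (p (\<rho> (\<omega> i) \<theta>)))"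

definition npml_estimator ::
  "real set \<Rightarrow> real \<Rightarrow> real \<Rightarrow> real \<Rightarrow> ('v \<Rightarrow> 'c \<Rightarrow> real) \<Rightarrow>
   nat \<Rightarrow> (nat \<Rightarrow> 'v) \<Rightarrow> 'c \<Rightarrow> real \<Rightarrow> real" where
  "npml_estimator \<Omega> t \<zeta> D \<rho> k \<omega> \<theta> =
     (THE p. is_arg_max (mean_log_likelihood \<rho> k \<omega> \<theta>) (\<lambda>q. q \<in> sobolev_densities \<Omega> t \<zeta> D) p)"

definition npml_process ::
  "real set \<Rightarrow> real \<Rightarrow> real \<Rightarrow> real \<Rightarrow> ('v \<Rightarrow> 'c \<Rightarrow> real) \<Rightarrow> ('c \<Rightarrow> real \<Rightarrow> real) \<Rightarrow>
   nat \<Rightarrow> (nat \<Rightarrow> 'v) \<Rightarrow> 'c \<Rightarrow> (real \<Rightarrow> real) \<Rightarrow> real" where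
  "npml_process \<Omega> t \<zeta> D \<rho> p k \<omega> \<theta> f =
     sqrt (real k) * (\<integral>x. (npml_estimator \<Omega> t \<zeta> D \<rho> k \<omega> \<theta> x - p \<theta> x) * f x \<partial>lborel_on \<Omega>)"


section \<open>Weak convergence of possibly non-measurable maps\<close>

abbreviation linf :: "'i set \<Rightarrow> ('i \<Rightarrow> real) metric" where
  "linf \<Lambda> \<equiv> funspace \<Lambda> euclidean_metric"

definition borel_of_metric :: "'a metric \<Rightarrow> 'a measure" where
  "borel_of_metric m = sigma (mspace m) {U. openin (mtopology_of m) U}"

definition separable_range :: "'w measure \<Rightarrow> 'a metric \<Rightarrow> ('w \<Rightarrow> 'a) \<Rightarrow> bool" where
  "separable_range M m Y \<longleftrightarrow> separable_space (subtopology (mtopology_of m) (Y ` space M))"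

text \<open>Only used for bounded integrands on probability spaces, for which it suffices to take
  real-valued integrable majorants.\<close>

definition outer_integral :: "'w measure \<Rightarrow> ('w \<Rightarrow> real) \<Rightarrow> real" where
  "outer_integral M T = Inf {integral\<^sup>L M U |U. integrable M U \<and> (\<forall>x\<in>space M. T x \<le> U x)}"

definition weakly_converges ::
  "'a metric \<Rightarrow> 'b measure \<Rightarrow> (nat \<Rightarrow> 'b \<Rightarrow> 'a) \<Rightarrow> 'w measure \<Rightarrow> ('w \<Rightarrow> 'a) \<Rightarrow> bool" where
  "weakly_converges m P Y Q Z \<longleftrightarrow>
     (\<forall>k. Y k \<in> space P \<rightarrow> mspace m) \<and> Z \<in> measurable Q (borel_of_metric m) \<and>
     (\<forall>g. continuous_map (mtopology_of m) euclideanreal g \<and> bounded (g ` mspace m) \<longrightarrow>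
        (\<lambda>k. outer_integral P (\<lambda>\<omega>. g (Y k \<omega>))) \<longlonglongrightarrow> (\<integral>w. g (Z w) \<partial>Q))"

definition BL_norm :: "'a metric \<Rightarrow> ('a \<Rightarrow> real) \<Rightarrow> ennreal" where
  "BL_norm m h =
     (SUP x\<in>mspace m. ennreal \<bar>h x\<bar>) +
     (SUP (x, y)\<in>{(x, y). x \<in> mspace m \<and> y \<in> mspace m \<and> x \<noteq> y}. ennreal (\<bar>h x - h y\<bar> / mdist m x y))"

definition BL_dist ::
  "'a metric \<Rightarrow> 'b measure \<Rightarrow> ('b \<Rightarrow> 'a) \<Rightarrow> 'w measure \<Rightarrow> ('w \<Rightarrow> 'a) \<Rightarrow> real" where
  "BL_dist m P Y Q Z =
     (SUP h\<in>{h. BL_norm m h \<le> 1}. \<bar>outer_integral P (\<lambda>\<omega>. h (Y \<omega>)) - (\<integral>w. h (Z w) \<partial>Q)\<bar>)"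


section \<open>Gaussian processes and Brownian bridges\<close>

text \<open>Normal laws include the degenerate ones (\<open>\<sigma> = 0\<close>).\<close>

definition normal_rv :: "'w measure \<Rightarrow> ('w \<Rightarrow> real) \<Rightarrow> bool" where
  "normal_rv M X \<longleftrightarrow> X \<in> borel_measurable M \<and>
     (\<exists>m. \<exists>\<sigma>\<ge>0. distr M borel X =
        (if \<sigma> = 0 then return borel m else density lborel (\<lambda>x. ennreal (normal_density m \<sigma> x))))"

definition gaussian_process :: "'w measure \<Rightarrow> 'i set \<Rightarrow> ('w \<Rightarrow> 'i \<Rightarrow> real) \<Rightarrow> bool" where
  "gaussian_process M T X \<longleftrightarrow>
     (\<forall>J c. finite J \<and> J \<subseteq> T \<longrightarrow> normal_rv M (\<lambda>w. \<Sum>j\<in>J. c j * X w j))"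

definition mean_zero :: "'w measure \<Rightarrow> 'i set \<Rightarrow> ('w \<Rightarrow> 'i \<Rightarrow> real) \<Rightarrow> bool" where
  "mean_zero M T X \<longleftrightarrow> (\<forall>i\<in>T. (\<integral>w. X w i \<partial>M) = 0)"

definition covariance :: "'w measure \<Rightarrow> ('w \<Rightarrow> real) \<Rightarrow> ('w \<Rightarrow> real) \<Rightarrow> real" where
  "covariance M X Y = (\<integral>w. (X w - (\<integral>v. X v \<partial>M)) * (Y w - (\<integral>v. Y v \<partial>M)) \<partial>M)"

definition sd_metric :: "'w measure \<Rightarrow> ('w \<Rightarrow> 'i \<Rightarrow> real) \<Rightarrow> 'i \<Rightarrow> 'i \<Rightarrow> real" where
  "sd_metric M X i j = sqrt (prob_space.variance M (\<lambda>w. X w i - X w j))"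

definition sd_uniformly_continuous_paths ::
  "'w measure \<Rightarrow> 'i set \<Rightarrow> ('w \<Rightarrow> 'i \<Rightarrow> real) \<Rightarrow> bool" where
  "sd_uniformly_continuous_paths M T X \<longleftrightarrow>
     (\<forall>w\<in>space M. \<forall>\<epsilon>>0. \<exists>\<delta>>0. \<forall>i\<in>T. \<forall>j\<in>T. sd_metric M X i j < \<delta> \<longrightarrow> \<bar>X w i - X w j\<bar> < \<epsilon>)"

definition brownian_bridge ::
  "'w measure \<Rightarrow> real measure \<Rightarrow> (real \<Rightarrow> real) set \<Rightarrow> ('w \<Rightarrow> (real \<Rightarrow> real) \<Rightarrow> real) \<Rightarrow> bool" where
  "brownian_bridge Q P \<F> B \<longleftrightarrow>
     gaussian_process Q \<F> B \<and> mean_zero Q \<F> B \<and>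
     B \<in> measurable Q (borel_of_metric (linf \<F>)) \<and>
     (\<forall>f\<in>\<F>. \<forall>g\<in>\<F>. covariance Q (\<lambda>w. B w f) (\<lambda>w. B w g) =
        (\<integral>x. f x * g x \<partial>P) - (\<integral>x. f x \<partial>P) * (\<integral>x. g x \<partial>P)) \<and>
     sd_uniformly_continuous_paths Q \<F> B"

end

theory Submission
  imports Defs
begin

text \<open>
  Evaluation at \<open>\<theta>\<close> is a 1-Lipschitz map from \<open>\<ell>\<^sup>\<infinity>(\<Theta> \<times> \<F>)\<close> to \<open>\<ell>\<^sup>\<infinity>(\<F>)\<close>, so each bounded Lipschitz
  distance on \<open>\<ell>\<^sup>\<infinity>(\<F>)\<close> is at most the one between the whole processes, uniformly in \<open>\<theta>\<close>. The latter
  tends to zero because weak convergence to a limit with separable range is uniform over the unit ball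
  of the bounded Lipschitz functions: up to a set of small probability the limit lives in finitely many
  small balls, and on these a function of the unit ball is determined, up to a small error, by its
  rounded values at the finitely many centres.
\<close>

section \<open>The class of bounded Lipschitz test functions\<close>

text \<open>The bounds on size and on Lipschitz constant are imposed separately, not on their sum,
  so the class contains every \<open>h\<close> with \<open>BL_norm m h \<le> 1\<close>. Uniform
  convergence over this larger class is therefore enough for \<open>BL_dist\<close>, and its
  conditions are plain real inequalities.\<close>

definition BL_unit_ball :: "'a metric \<Rightarrow> ('a \<Rightarrow> real) set" where
  "BL_unit_ball m = {h. (\<forall>x\<in>mspace m. \<bar>h x\<bar> \<le> 1) \<and>
     (\<forall>x\<in>mspace m. \<forall>y\<in>mspace m. \<bar>h x - h y\<bar> \<le> mdist m x y)}"

lemma BL_unit_ballD: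
  assumes "h \<in> BL_unit_ball m" "x \<in> mspace m"
  shows BL_unit_ball_bound: "\<bar>h x\<bar> \<le> 1"
    and BL_unit_ball_Lipschitz: "y \<in> mspace m \<Longrightarrow> \<bar>h x - h y\<bar> \<le> mdist m x y"
  using assms by (auto simp: BL_unit_ball_def)

text \<open>Both suprema in \<open>BL_norm\<close> are nonnegative, so each is at most their sum.
  The difference quotient can be cleared because distinct points of \<open>mspace m\<close> have
  positive distance.\<close>

lemma BL_norm_le_1_imp_BL_unit_ball:
  assumes "BL_norm m h \<le> 1"
  shows "h \<in> BL_unit_ball m"
proof -
  let ?A = "SUP x\<in>mspace m. ennreal \<bar>h x\<bar>"
  let ?B = "SUP (x, y)\<in>{(x, y). x \<in> mspace m \<and> y \<in> mspace m \<and> x \<noteq> y}.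
    ennreal (\<bar>h x - h y\<bar> / mdist m x y)"
  have AB: "?A + ?B \<le> 1"
    using assms by (simp add: BL_norm_def)
  have A: "?A \<le> 1" and B: "?B \<le> 1"
    using add_increasing2[of ?B ?A ?A] add_increasing[of ?A ?B ?B] order.trans[OF _ AB] by auto
  have "\<bar>h x\<bar> \<le> 1" if "x \<in> mspace m" for x
  proof -
    have "ennreal \<bar>h x\<bar> \<le> 1"
      using A that by (meson SUP_upper order.trans)
    then show ?thesis by simp
  qed
  moreover have "\<bar>h x - h y\<bar> \<le> mdist m x y" if "x \<in> mspace m" "y \<in> mspace m" for x y
  proof (cases "x = y")
    case False
    then have pos: "mdist m x y > 0"
      using False that by (metis less_eq_real_def mdist_nonneg mdist_zero)
    have "ennreal (\<bar>h x - h y\<bar> / mdist m x y) \<le> ?B"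
      by (rule SUP_upper2[of "(x, y)"]) (use that False in auto)
    then have "ennreal (\<bar>h x - h y\<bar> / mdist m x y) \<le> 1"
      using B by (rule order.trans)
    then have "\<bar>h x - h y\<bar> / mdist m x y \<le> 1" by simp
    then show ?thesis
      using pos by (simp add: divide_le_eq)
  qed simp
  ultimately show ?thesis
    by (simp add: BL_unit_ball_def)
qed

text \<open>The zero function makes the index set of the supremum in \<open>BL_dist\<close>
  non-empty and serves as the test function that shows the supremum to be nonnegative.\<close>

lemma BL_norm_zero: "BL_norm m (\<lambda>_. 0) = 0"
proof -
  have "BL_norm m (\<lambda>_. 0) \<le> 0 + 0"
    unfolding BL_norm_def by (intro add_mono SUP_least) auto
  then show ?thesis by simp
qed

lemma BL_unit_ball_continuous_map:
  assumes "h \<in> BL_unit_ball m"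
  shows "continuous_map (mtopology_of m) euclideanreal h"
proof -
  have "Lipschitz_continuous_map m euclidean_metric h"
    unfolding Lipschitz_continuous_map_def
    using BL_unit_ball_Lipschitz[OF assms] by (auto simp: dist_real_def intro!: exI[of _ 1])
  then show ?thesis
    using Lipschitz_continuous_imp_continuous_map by fastforce
qed

text \<open>Non-expansive maps preserve both bounds. This turns test functions on
  \<ell>\<infinity>(\<F>) into test functions on \<ell>\<infinity>(\<Theta> \<times> \<F>).\<close>

lemma BL_unit_ball_comp:
  assumes "h \<in> BL_unit_ball m'" "\<pi> \<in> mspace m \<rightarrow> mspace m'"
    and "\<And>x y. x \<in> mspace m \<Longrightarrow> y \<in> mspace m \<Longrightarrow> mdist m' (\<pi> x) (\<pi> y) \<le> mdist m x y"
  shows "(\<lambda>x. h (\<pi> x)) \<in> BL_unit_ball m"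
  unfolding BL_unit_ball_def
proof (intro CollectI conjI ballI)
  fix x y assume xy: "x \<in> mspace m" "y \<in> mspace m"
  then have \<pi>: "\<pi> x \<in> mspace m'" "\<pi> y \<in> mspace m'"
    using assms(2) by blast+
  show "\<bar>h (\<pi> x)\<bar> \<le> 1"
    by (rule BL_unit_ball_bound[OF assms(1) \<pi>(1)])
  show "\<bar>h (\<pi> x) - h (\<pi> y)\<bar> \<le> mdist m x y"
    by (rule order.trans[OF BL_unit_ball_Lipschitz[OF assms(1) \<pi>] assms(3)[OF xy]])
qed

text \<open>On \<open>C\<close> the values lie in [-1, 1], so rounding them to multiples of
  \<epsilon> leaves finitely many patterns, and one representative per pattern suffices. The
  representatives come from the class itself, so that weak convergence applies to them.\<close>

lemma finite_net_BL_unit_ball: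
  assumes "finite C" "C \<subseteq> mspace m" "\<epsilon> > 0"
  obtains H where "finite H" "H \<subseteq> BL_unit_ball m"
    "\<And>h. h \<in> BL_unit_ball m \<Longrightarrow> \<exists>h'\<in>H. \<forall>c\<in>C. \<bar>h c - h' c\<bar> \<le> \<epsilon>"
proof -
  define r where "r h = (\<lambda>c\<in>C. \<lfloor>h c / \<epsilon>\<rfloor>)" for h :: "'a \<Rightarrow> real"
  have "r ` BL_unit_ball m \<subseteq> (\<Pi>\<^sub>E c\<in>C. {\<lfloor>- 1 / \<epsilon>\<rfloor>..\<lfloor>1 / \<epsilon>\<rfloor>})"
  proof (clarify, unfold r_def, rule restrict_PiE_iff[THEN iffD2], clarify)
    fix h c assume "h \<in> BL_unit_ball m" "c \<in> C"
    then have "\<bar>h c\<bar> \<le> 1"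
      using assms(2) by (auto dest: BL_unit_ball_bound)
    then have "- 1 / \<epsilon> \<le> h c / \<epsilon>" "h c / \<epsilon> \<le> 1 / \<epsilon>"
      using assms(3) by (auto intro!: divide_right_mono simp del: divide_minus_left)
    then show "\<lfloor>h c / \<epsilon>\<rfloor> \<in> {\<lfloor>- 1 / \<epsilon>\<rfloor>..\<lfloor>1 / \<epsilon>\<rfloor>}"
      by (auto intro: floor_mono simp del: divide_minus_left)
  qed
  then have "finite (r ` BL_unit_ball m)"
    by (rule finite_subset) (simp add: assms(1) finite_PiE)
  \<comment> \<open>Selects one function of the class for each rounding pattern.\<close>
  from finite_subset_image[OF this order.refl]
  obtain H where H: "H \<subseteq> BL_unit_ball m" "finite H" "r ` BL_unit_ball m = r ` H"
    by blast
  show thesis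
  proof (rule that[OF H(2,1)])
    fix h assume "h \<in> BL_unit_ball m"
    then obtain h' where h': "h' \<in> H" "r h = r h'"
      using H(3) by blast
    have "\<bar>h c - h' c\<bar> \<le> \<epsilon>" if "c \<in> C" for c
    proof -
      have "\<lfloor>h c / \<epsilon>\<rfloor> = \<lfloor>h' c / \<epsilon>\<rfloor>"
        using fun_cong[OF h'(2), of c] that by (simp add: r_def)
      then have "\<bar>h c / \<epsilon> - h' c / \<epsilon>\<bar> \<le> 1"
        by linarith
      then have "\<bar>(h c - h' c) / \<epsilon>\<bar> \<le> 1"
        by (simp add: diff_divide_distrib)
      then show ?thesis
        using assms(3) by (simp add: abs_divide divide_le_eq)
    qed
    then show "\<exists>h'\<in>H. \<forall>c\<in>C. \<bar>h c - h' c\<bar> \<le> \<epsilon>"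
      using h'(1) by blast
  qed
qed

section \<open>Outer integrals of bounded functions\<close>

text \<open>The bound \<open>B\<close> from below keeps the set of majorant integrals bounded below;
  otherwise its real infimum need not be a lower bound.\<close>

lemma (in prob_space) outer_integral_lower:
  assumes "integrable M U" "\<And>x. x \<in> space M \<Longrightarrow> T x \<le> U x" "\<And>x. x \<in> space M \<Longrightarrow> B \<le> T x"
  shows "outer_integral M T \<le> integral\<^sup>L M U"
  unfolding outer_integral_def
proof (rule cInf_lower)
  show "bdd_below {integral\<^sup>L M U |U. integrable M U \<and> (\<forall>x\<in>space M. T x \<le> U x)}"
  proof (rule bdd_belowI[of _ B], clarify)
    fix U assume U: "integrable M U" "\<forall>x\<in>space M. T x \<le> U x"
    have "(\<integral>x. B \<partial>M) \<le> integral\<^sup>L M U"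
      using U assms(3) by (intro integral_mono) (auto intro: order.trans)
    then show "B \<le> integral\<^sup>L M U"
      by (simp add: prob_space)
  qed
qed (use assms in auto)

text \<open>The constant \<open>B\<close> is an integrable majorant, so the infimum is over a
  non-empty set and can be approached within \<open>e\<close>.\<close>

lemma (in prob_space) outer_integral_approx:
  assumes "\<And>x. x \<in> space M \<Longrightarrow> T x \<le> B" "e > 0"
  shows "\<exists>U. integrable M U \<and> (\<forall>x\<in>space M. T x \<le> U x) \<and>
    integral\<^sup>L M U < outer_integral M T + e"
proof -
  let ?S = "{integral\<^sup>L M U |U. integrable M U \<and> (\<forall>x\<in>space M. T x \<le> U x)}"
  have "integral\<^sup>L M (\<lambda>_. B) \<in> ?S"
    by (intro CollectI exI[of _ "\<lambda>_. B"]) (use assms(1) in auto)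
  then have "?S \<noteq> {}" by blast
  moreover have "Inf ?S < outer_integral M T + e"
    using assms(2) by (simp add: outer_integral_def)
  ultimately obtain z where "z \<in> ?S" "z < outer_integral M T + e"
    using cInf_lessD[of ?S] by blast
  then show ?thesis
    by blast
qed

text \<open>This takes the place of linearity for integrands that may fail to be measurable: nearly
  optimal majorants of \<open>T2\<close> and \<open>T3\<close> combine to a majorant of
  \<open>T1\<close>.\<close>

lemma (in prob_space) outer_integral_le_add_mult:
  assumes T1: "\<And>x. x \<in> space M \<Longrightarrow> B1 \<le> T1 x"
    and T2: "\<And>x. x \<in> space M \<Longrightarrow> T2 x \<le> B2"
    and T3: "\<And>x. x \<in> space M \<Longrightarrow> T3 x \<le> B3"
    and le: "\<And>x. x \<in> space M \<Longrightarrow> T1 x \<le> T2 x + c + b * T3 x" and "b \<ge> 0"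
  shows "outer_integral M T1 \<le> outer_integral M T2 + c + b * outer_integral M T3"
proof (rule field_le_epsilon)
  fix e :: real assume "e > 0"
  \<comment> \<open>The majorant of \<open>T2\<close> loses \<open>d\<close> and that of
    \<open>T3\<close>, weighted by \<open>b\<close>, loses \<open>b * d\<close>; together this is
    \<open>e\<close>.\<close>
  define d where "d = e / (1 + b)"
  have d: "d > 0" "(1 + b) * d = e"
    using \<open>e > 0\<close> \<open>b \<ge> 0\<close> by (auto simp: d_def)
  obtain U2 where U2: "integrable M U2" "\<And>x. x \<in> space M \<Longrightarrow> T2 x \<le> U2 x"
    "integral\<^sup>L M U2 < outer_integral M T2 + d"
    using outer_integral_approx[of T2 B2, OF T2 d(1)] by auto
  obtain U3 where U3: "integrable M U3" "\<And>x. x \<in> space M \<Longrightarrow> T3 x \<le> U3 x"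
    "integral\<^sup>L M U3 < outer_integral M T3 + d"
    using outer_integral_approx[of T3 B3, OF T3 d(1)] by auto
  have "outer_integral M T1 \<le> (\<integral>x. U2 x + c + b * U3 x \<partial>M)"
  proof (rule outer_integral_lower)
    show "integrable M (\<lambda>x. U2 x + c + b * U3 x)"
      using U2(1) U3(1) by auto
    fix x assume x: "x \<in> space M"
    have "b * T3 x \<le> b * U3 x"
      using U3(2)[OF x] \<open>b \<ge> 0\<close> by (rule mult_left_mono)
    then show "T1 x \<le> U2 x + c + b * U3 x"
      using le[OF x] U2(2)[OF x] by linarith
  qed (rule T1)
  also have "\<dots> = integral\<^sup>L M U2 + c + b * integral\<^sup>L M U3"
    using U2(1) U3(1) by (simp add: prob_space)
  also have "\<dots> \<le> (outer_integral M T2 + d) + c + b * (outer_integral M T3 + d)"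
    using U2(3) U3(3) \<open>b \<ge> 0\<close> by (intro add_mono mult_left_mono) auto
  also have "\<dots> = outer_integral M T2 + c + b * outer_integral M T3 + e"
    using d(2) by (simp add: algebra_simps)
  finally show "outer_integral M T1 \<le> outer_integral M T2 + c + b * outer_integral M T3 + e" .
qed

section \<open>Measurability and separability under continuous maps\<close>

lemma space_borel_of_metric [simp]: "space (borel_of_metric m) = mspace m"
  unfolding borel_of_metric_def by (rule space_measure_of) (use openin_subset in fastforce)

lemma sets_borel_of_metric:
  "sets (borel_of_metric m) = sigma_sets (mspace m) {U. openin (mtopology_of m) U}"
  unfolding borel_of_metric_def
  by (rule sets_measure_of) (use openin_subset in fastforce)

lemma measurable_borel_of_metric_continuous_map:
  assumes "continuous_map (mtopology_of m) (mtopology_of m') \<pi>"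
  shows "\<pi> \<in> measurable (borel_of_metric m) (borel_of_metric m')"
proof (rule measurable_sigma_sets[OF sets_borel_of_metric])
  show "{U. openin (mtopology_of m') U} \<subseteq> Pow (mspace m')"
    using openin_subset by fastforce
  show "\<pi> \<in> space (borel_of_metric m) \<rightarrow> mspace m'"
    using continuous_map_funspace[OF assms] by simp
  fix U assume "U \<in> {U. openin (mtopology_of m') U}"
  then have "openin (mtopology_of m) {x \<in> topspace (mtopology_of m). \<pi> x \<in> U}"
    using assms by (intro openin_continuous_map_preimage) auto
  moreover have "\<pi> -` U \<inter> space (borel_of_metric m) = {x \<in> topspace (mtopology_of m). \<pi> x \<in> U}"
    by auto
  ultimately show "\<pi> -` U \<inter> space (borel_of_metric m) \<in> sets (borel_of_metric m)"
    by (auto simp: sets_borel_of_metric)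
qed

lemma borel_measurable_continuous_map:
  assumes "continuous_map (mtopology_of m) euclideanreal g"
  shows "g \<in> borel_measurable (borel_of_metric m)"
proof -
  have "borel_of_metric (euclidean_metric :: real metric) = borel"
    by (simp add: borel_of_metric_def borel_def)
  then show ?thesis
    using measurable_borel_of_metric_continuous_map[of m euclidean_metric g] assms by simp
qed

text \<open>Between the two ranges, taken as subspaces, \<pi> is a continuous surjection, and
  continuous images of separable spaces are separable.\<close>

lemma separable_range_comp:
  assumes "separable_range Q m Z" "continuous_map (mtopology_of m) (mtopology_of m') \<pi>"
    and "Z \<in> space Q \<rightarrow> mspace m"
  shows "separable_range Q m' (\<lambda>w. \<pi> (Z w))"
  unfolding separable_range_def
proof (rule separable_space_continuous_map_image)
  let ?X = "subtopology (mtopology_of m) (Z ` space Q)"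
  let ?Y = "subtopology (mtopology_of m') ((\<lambda>w. \<pi> (Z w)) ` space Q)"
  show "separable_space ?X"
    using assms(1) by (simp add: separable_range_def)
  show "continuous_map ?X ?Y \<pi>"
    by (auto simp: continuous_map_in_subtopology intro!: continuous_map_from_subtopology assms(2))
  show "\<pi> ` topspace ?X = topspace ?Y"
    using assms(3) continuous_map_funspace[OF assms(2)] by fastforce
qed

section \<open>Continuous cutoffs and approximation by finitely many balls\<close>

text \<open>The product over the centres serves as a continuous substitute for the indicator function of
  the complement of the union of the balls.\<close>

definition outside_balls :: "'a metric \<Rightarrow> real \<Rightarrow> 'a set \<Rightarrow> 'a \<Rightarrow> real" where
  "outside_balls m \<epsilon> C x = (\<Prod>c\<in>C. min 1 (max 0 (mdist m c x / \<epsilon> - 1)))"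

lemma outside_balls_nonneg: "0 \<le> outside_balls m \<epsilon> C x"
  unfolding outside_balls_def by (rule prod_nonneg) auto

lemma outside_balls_le_1: "outside_balls m \<epsilon> C x \<le> 1"
  unfolding outside_balls_def by (rule prod_le_1) auto

lemma continuous_map_outside_balls:
  assumes "finite C" "C \<subseteq> mspace m"
  shows "continuous_map (mtopology_of m) euclideanreal (outside_balls m \<epsilon> C)"
  \<comment> \<open>Division becomes multiplication by a constant, so continuity holds for every
    \<epsilon>, zero included.\<close>
  unfolding outside_balls_def divide_inverse
  using assms
  by (intro continuous_map_prod continuous_map_real_min continuous_map_real_max continuous_map_diff
      continuous_map_real_mult continuous_map_const[THEN iffD2] continuous_map_mdist) auto

text \<open>Each factor rises from 0 at distance \<epsilon> to 1 at distance 2\<epsilon>, so a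
  single close centre annihilates the product.\<close>

lemma outside_balls_eq_0:
  assumes "finite C" "c \<in> C" "mdist m c x \<le> \<epsilon>" "\<epsilon> > 0"
  shows "outside_balls m \<epsilon> C x = 0"
  unfolding outside_balls_def using assms by (intro prod_zero) (auto simp: divide_le_eq intro!: bexI[of _ c])

lemma outside_balls_eq_1:
  assumes "\<And>c. c \<in> C \<Longrightarrow> mdist m c x \<ge> 2 * \<epsilon>" "\<epsilon> > 0"
  shows "outside_balls m \<epsilon> C x = 1"
  unfolding outside_balls_def
proof (intro prod.neutral ballI)
  fix c assume "c \<in> C"
  then have "2 \<le> mdist m c x / \<epsilon>"
    using assms by (simp add: le_divide_eq)
  then show "min 1 (max 0 (mdist m c x / \<epsilon> - 1)) = 1"
    by simp
qed

text \<open>Within 2\<epsilon> of a centre, going from \<open>x\<close> to the centre, from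
  \<open>h\<close> to \<open>h'\<close> and back to \<open>x\<close> costs 2\<epsilon> + \<epsilon>
  + 2\<epsilon>. Away from all centres the cutoff equals 1, and the trivial bound 2 is covered by
  its coefficient.\<close>

lemma BL_unit_ball_diff_le:
  assumes h: "h \<in> BL_unit_ball m" "h' \<in> BL_unit_ball m" and x: "x \<in> mspace m"
    and C: "C \<subseteq> mspace m" "\<And>c. c \<in> C \<Longrightarrow> \<bar>h c - h' c\<bar> \<le> \<epsilon>" and "\<epsilon> > 0"
  shows "\<bar>h x - h' x\<bar> \<le> 5 * \<epsilon> + 2 * outside_balls m \<epsilon> C x"
proof (cases "\<exists>c\<in>C. mdist m c x < 2 * \<epsilon>")
  case True
  then obtain c where c: "c \<in> C" "mdist m c x < 2 * \<epsilon>" by blast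
  then have "\<bar>h c - h x\<bar> < 2 * \<epsilon>" "\<bar>h' c - h' x\<bar> < 2 * \<epsilon>" "\<bar>h c - h' c\<bar> \<le> \<epsilon>"
    using C BL_unit_ball_Lipschitz[of _ m c x] h x by force+
  then show ?thesis
    using outside_balls_nonneg[of m \<epsilon> C x] by linarith
next
  case False
  then have "outside_balls m \<epsilon> C x = 1"
    using \<open>\<epsilon> > 0\<close> by (intro outside_balls_eq_1) (auto simp: not_less)
  moreover have "\<bar>h x\<bar> \<le> 1" "\<bar>h' x\<bar> \<le> 1"
    using h x by (auto dest: BL_unit_ball_bound)
  ultimately show ?thesis
    using \<open>\<epsilon> > 0\<close> by linarith
qed

text \<open>Enumerate a countable dense subset of the range. Every value of \<open>Z\<close> is
  within \<epsilon> of some centre, so the cutoffs for the first \<open>n\<close> centres eventually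
  vanish at each point, and dominated convergence makes their expectations small.\<close>

lemma (in prob_space) separable_range_outside_balls:
  assumes Z: "Z \<in> measurable M (borel_of_metric m)" and sep: "separable_range M m Z" and "\<epsilon> > 0"
  obtains C where "finite C" "C \<subseteq> mspace m" "(\<integral>w. outside_balls m \<epsilon> C (Z w) \<partial>M) < \<epsilon>"
proof -
  have Zm: "Z w \<in> mspace m" if "w \<in> space M" for w
    using measurable_space[OF Z that] by simp
  define X where "X = subtopology (mtopology_of m) (Z ` space M)"
  have topX: "topspace X = Z ` space M"
    using Zm by (auto simp: X_def)
  obtain C where C: "countable C" "C \<subseteq> Z ` space M" "X closure_of C = Z ` space M"
    using sep unfolding separable_range_def separable_space_def X_def[symmetric] topX by blast
  \<comment> \<open>A probability space has points, so the range of \<open>Z\<close> is non-empty,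
    and hence so is its dense subset; only then does \<open>from_nat_into\<close> enumerate exactly
    \<open>C\<close>.\<close>
  have "C \<noteq> {}"
    using C(3) not_empty by auto
  define c where "c = from_nat_into C"
  have rc: "range c = C"
    unfolding c_def using range_from_nat_into[OF \<open>C \<noteq> {}\<close> C(1)] .
  have cm: "c ` {..<n} \<subseteq> mspace m" for n
  proof -
    have "Z ` space M \<subseteq> mspace m" using Zm by blast
    then show ?thesis using rc C(2) by blast
  qed
  have near: "\<exists>i. mdist m (c i) (Z w) < \<epsilon>" if w: "w \<in> space M" for w
  proof -
    interpret m: Metric_space "mspace m" "mdist m" by (rule Metric_space_mspace_mdist)
    \<comment> \<open>The trace of the ball is open in the range, so it must meet the dense set
      \<open>C\<close>.\<close>
    define U where "U = m.mball (Z w) \<epsilon> \<inter> Z ` space M"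
    have "openin X U"
      unfolding X_def U_def by (auto simp: openin_subtopology mtopology_of_def)
    moreover have "Z w \<in> U"
      using w Zm[OF w] \<open>\<epsilon> > 0\<close> by (simp add: U_def)
    moreover have "Z w \<in> X closure_of C"
      using C(3) w by simp
    ultimately obtain y where "y \<in> C" "y \<in> U"
      by (auto simp: in_closure_of)
    then have "y \<in> C" "y \<in> m.mball (Z w) \<epsilon>"
      by (simp_all add: U_def)
    then show ?thesis
      using rc by (metis m.in_mball m.commute rangeE)
  qed
  have "(\<lambda>n. \<integral>w. outside_balls m \<epsilon> (c ` {..<n}) (Z w) \<partial>M) \<longlonglongrightarrow> (\<integral>w. 0 \<partial>M)"
  proof (rule integral_dominated_convergence[where w = "\<lambda>_. 1"])
    show "(\<lambda>w. outside_balls m \<epsilon> (c ` {..<n}) (Z w)) \<in> borel_measurable M" for n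
      using measurable_compose[OF Z borel_measurable_continuous_map]
        continuous_map_outside_balls[OF _ cm] by simp
    show "AE w in M. (\<lambda>n. outside_balls m \<epsilon> (c ` {..<n}) (Z w)) \<longlonglongrightarrow> 0"
    proof (rule AE_I2)
      fix w assume "w \<in> space M"
      then obtain i where i: "mdist m (c i) (Z w) < \<epsilon>" using near by blast
      have "\<forall>\<^sub>F n in sequentially. outside_balls m \<epsilon> (c ` {..<n}) (Z w) = 0"
        using eventually_gt_at_top[of i]
        by eventually_elim (rule outside_balls_eq_0[of _ "c i"], use i \<open>\<epsilon> > 0\<close> in auto)
      then show "(\<lambda>n. outside_balls m \<epsilon> (c ` {..<n}) (Z w)) \<longlonglongrightarrow> 0"
        by (rule tendsto_eventually)
    qed
    show "AE w in M. norm (outside_balls m \<epsilon> (c ` {..<n}) (Z w)) \<le> 1" for n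
      by (simp add: outside_balls_nonneg outside_balls_le_1)
  qed auto
  then have "\<forall>\<^sub>F n in sequentially. (\<integral>w. outside_balls m \<epsilon> (c ` {..<n}) (Z w) \<partial>M) < \<epsilon>"
    using \<open>\<epsilon> > 0\<close> by (intro order_tendstoD(2)) auto
  then obtain n where "(\<integral>w. outside_balls m \<epsilon> (c ` {..<n}) (Z w) \<partial>M) < \<epsilon>"
    by (auto simp: eventually_sequentially)
  then show thesis
    by (intro that[of "c ` {..<n}"] cm) auto
qed

section \<open>Uniformity of weak convergence over the test functions\<close>

text \<open>Weak convergence is used only for the cutoff and for the finitely many members of the
  net, so one index serves them all. Passing from \<open>h\<close> to a member of the net is paid
  for by the cutoff, under both laws.\<close>

lemma weakly_converges_imp_uniform_BL:
  assumes wc: "weakly_converges m P Y Q Z" and sep: "separable_range Q m Z"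
    and P: "prob_space P" and Q: "prob_space Q" and "e > 0"
  shows "\<forall>\<^sub>F k in sequentially. \<forall>h\<in>BL_unit_ball m.
    \<bar>outer_integral P (\<lambda>\<omega>. h (Y k \<omega>)) - (\<integral>w. h (Z w) \<partial>Q)\<bar> \<le> e"
proof -
  interpret P: prob_space P by (rule P)
  interpret Q: prob_space Q by (rule Q)
  \<comment> \<open>The total error is 17\<epsilon>: 5\<epsilon> + 2 * 2\<epsilon> on the side of
    \<open>Y k\<close>, 5\<epsilon> + 2\<epsilon> on the side of \<open>Z\<close>, and \<epsilon>
    for the member of the net.\<close>
  define \<epsilon> where "\<epsilon> = e / 17"
  have "\<epsilon> > 0" using \<open>e > 0\<close> by (simp add: \<epsilon>_def)
  have Y: "\<And>k \<omega>. \<omega> \<in> space P \<Longrightarrow> Y k \<omega> \<in> mspace m"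
    and Z: "Z \<in> measurable Q (borel_of_metric m)"
    and conv: "\<And>g. continuous_map (mtopology_of m) euclideanreal g \<Longrightarrow> bounded (g ` mspace m) \<Longrightarrow>
        (\<lambda>k. outer_integral P (\<lambda>\<omega>. g (Y k \<omega>))) \<longlonglongrightarrow> (\<integral>w. g (Z w) \<partial>Q)"
    using wc by (auto simp: weakly_converges_def)
  have Zm: "Z w \<in> mspace m" if "w \<in> space Q" for w
    using measurable_space[OF Z that] by simp
  obtain C where C: "finite C" "C \<subseteq> mspace m" "(\<integral>w. outside_balls m \<epsilon> C (Z w) \<partial>Q) < \<epsilon>"
    by (rule Q.separable_range_outside_balls[OF Z sep \<open>\<epsilon> > 0\<close>])
  let ?\<phi> = "outside_balls m \<epsilon> C"
  note cont\<phi> = continuous_map_outside_balls[OF C(1,2), of \<epsilon>]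
  obtain H where H: "finite H" "H \<subseteq> BL_unit_ball m"
    "\<And>h. h \<in> BL_unit_ball m \<Longrightarrow> \<exists>h'\<in>H. \<forall>c\<in>C. \<bar>h c - h' c\<bar> \<le> \<epsilon>"
    using finite_net_BL_unit_ball[OF C(1,2) \<open>\<epsilon> > 0\<close>] by blast
  have intH: "integrable Q (\<lambda>w. h (Z w))" if "h \<in> BL_unit_ball m" for h
    using BL_unit_ball_bound[OF that Zm]
    by (intro Q.integrable_const_bound[where B = 1] AE_I2
        measurable_compose[OF Z borel_measurable_continuous_map] BL_unit_ball_continuous_map that) simp
  have int\<phi>: "integrable Q (\<lambda>w. ?\<phi> (Z w))"
    by (intro Q.integrable_const_bound[where B = 1] AE_I2
        measurable_compose[OF Z borel_measurable_continuous_map] cont\<phi>)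
      (simp add: outside_balls_nonneg outside_balls_le_1)
  have "bounded (?\<phi> ` mspace m)"
    by (rule boundedI[of _ 1]) (auto simp: outside_balls_nonneg outside_balls_le_1)
  \<comment> \<open>Continuity of the cutoff carries its small expectation over from
    \<open>Z\<close> to \<open>Y k\<close>, with 2\<epsilon> leaving room above the limit.\<close>
  from conv[OF cont\<phi> this]
  have ev\<phi>: "\<forall>\<^sub>F k in sequentially. outer_integral P (\<lambda>\<omega>. ?\<phi> (Y k \<omega>)) < 2 * \<epsilon>"
    by (rule order_tendstoD(2)) (use C(3) \<open>\<epsilon> > 0\<close> in linarith)
  have "\<forall>\<^sub>F k in sequentially. \<bar>outer_integral P (\<lambda>\<omega>. h (Y k \<omega>)) - (\<integral>w. h (Z w) \<partial>Q)\<bar> < \<epsilon>"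
    if "h \<in> H" for h
  proof -
    have h: "h \<in> BL_unit_ball m" using that H(2) by blast
    have "bounded (h ` mspace m)"
      by (rule boundedI[of _ 1]) (auto dest: BL_unit_ball_bound[OF h])
    from tendstoD[OF conv[OF BL_unit_ball_continuous_map[OF h] this] \<open>\<epsilon> > 0\<close>]
    show ?thesis by (simp add: dist_real_def)
  qed
  then have "\<forall>\<^sub>F k in sequentially. \<forall>h\<in>H.
      \<bar>outer_integral P (\<lambda>\<omega>. h (Y k \<omega>)) - (\<integral>w. h (Z w) \<partial>Q)\<bar> < \<epsilon>"
    using H(1) by (simp add: eventually_ball_finite_distrib)
  then show ?thesis
    using ev\<phi>
  proof eventually_elim
    case (elim k)
    show ?case
    proof
      fix h assume h: "h \<in> BL_unit_ball m"
      then obtain h' where h': "h' \<in> H" "\<forall>c\<in>C. \<bar>h c - h' c\<bar> \<le> \<epsilon>"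
        using H(3) by blast
      have h'B: "h' \<in> BL_unit_ball m" using h'(1) H(2) by blast
      have diff: "\<bar>h x - h' x\<bar> \<le> 5 * \<epsilon> + 2 * ?\<phi> x" if "x \<in> mspace m" for x
        using BL_unit_ball_diff_le[OF h h'B that C(2) _ \<open>\<epsilon> > 0\<close>] h'(2) by blast
      \<comment> \<open>Outer integrals are not additive, so the difference is estimated by two
        one-sided inequalities, with \<open>h\<close> and \<open>h'\<close> exchanged.\<close>
      have outer: "outer_integral P (\<lambda>\<omega>. f (Y k \<omega>)) \<le>
          outer_integral P (\<lambda>\<omega>. g (Y k \<omega>)) + 5 * \<epsilon> + 2 * outer_integral P (\<lambda>\<omega>. ?\<phi> (Y k \<omega>))"
        if "f \<in> BL_unit_ball m" "g \<in> BL_unit_ball m"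
          and fg: "\<And>x. x \<in> mspace m \<Longrightarrow> \<bar>f x - g x\<bar> \<le> 5 * \<epsilon> + 2 * ?\<phi> x" for f g
      proof (rule P.outer_integral_le_add_mult[where ?B1.0 = "-1" and ?B2.0 = 1 and ?B3.0 = 1])
        fix \<omega> assume "\<omega> \<in> space P"
        from Y[OF this] have "Y k \<omega> \<in> mspace m" .
        then show "-1 \<le> f (Y k \<omega>)" "g (Y k \<omega>) \<le> 1"
          "f (Y k \<omega>) \<le> g (Y k \<omega>) + 5 * \<epsilon> + 2 * ?\<phi> (Y k \<omega>)"
          using that(1,2)[THEN BL_unit_ball_bound, of "Y k \<omega>"] fg[of "Y k \<omega>"] by linarith+
      qed (auto simp: outside_balls_le_1)
      have 1: "outer_integral P (\<lambda>\<omega>. h (Y k \<omega>)) \<le>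
          outer_integral P (\<lambda>\<omega>. h' (Y k \<omega>)) + 5 * \<epsilon> + 2 * outer_integral P (\<lambda>\<omega>. ?\<phi> (Y k \<omega>))"
        by (rule outer[OF h h'B diff])
      have 2: "outer_integral P (\<lambda>\<omega>. h' (Y k \<omega>)) \<le>
          outer_integral P (\<lambda>\<omega>. h (Y k \<omega>)) + 5 * \<epsilon> + 2 * outer_integral P (\<lambda>\<omega>. ?\<phi> (Y k \<omega>))"
        by (rule outer[OF h'B h]) (use diff in \<open>simp add: abs_minus_commute\<close>)
      have "\<bar>(\<integral>w. h (Z w) \<partial>Q) - (\<integral>w. h' (Z w) \<partial>Q)\<bar> = \<bar>\<integral>w. h (Z w) - h' (Z w) \<partial>Q\<bar>"
        using intH h h'B by simp
      also have "\<dots> \<le> (\<integral>w. \<bar>h (Z w) - h' (Z w)\<bar> \<partial>Q)"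
        by (rule integral_abs_bound)
      also have "\<dots> \<le> (\<integral>w. 5 * \<epsilon> + 2 * ?\<phi> (Z w) \<partial>Q)"
        using intH h h'B int\<phi> by (intro integral_mono diff Zm) auto
      also have "\<dots> = 5 * \<epsilon> + 2 * (\<integral>w. ?\<phi> (Z w) \<partial>Q)"
        using int\<phi> by (simp add: Q.prob_space)
      finally have 3: "\<bar>(\<integral>w. h (Z w) \<partial>Q) - (\<integral>w. h' (Z w) \<partial>Q)\<bar> \<le> 7 * \<epsilon>"
        using C(3) by linarith
      have "\<bar>outer_integral P (\<lambda>\<omega>. h' (Y k \<omega>)) - (\<integral>w. h' (Z w) \<partial>Q)\<bar> < \<epsilon>"
        using elim(1) h'(1) by blast
      then show "\<bar>outer_integral P (\<lambda>\<omega>. h (Y k \<omega>)) - (\<integral>w. h (Z w) \<partial>Q)\<bar> \<le> e"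
        using 1 2 3 elim(2) unfolding \<epsilon>_def by linarith
    qed
  qed
qed

section \<open>Sections of bounded functions on a product index set\<close>

lemma mspace_linf: "y \<in> mspace (linf \<Lambda>) \<longleftrightarrow> y \<in> extensional \<Lambda> \<and> bounded (y ` \<Lambda>)"
  by (simp add: Met_TC.fspace_def)

text \<open>Ensures that the real supremum defining the distance in \<open>linf\<close> really
  bounds each of its terms.\<close>

lemma bdd_above_dist_linf:
  assumes "x \<in> mspace (linf \<Lambda>)" "y \<in> mspace (linf \<Lambda>)"
  shows "bdd_above ((\<lambda>i. dist (x i) (y i)) ` \<Lambda>)"
proof -
  have "bounded (x ` \<Lambda>)" "bounded (y ` \<Lambda>)"
    using assms by (simp_all only: mspace_linf)
  then obtain a b where "\<forall>i\<in>\<Lambda>. norm (x i) \<le> a" "\<forall>i\<in>\<Lambda>. norm (y i) \<le> b"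
    by (auto simp: bounded_iff)
  then show ?thesis
    by (intro bdd_aboveI[of _ "a + b"]) (force simp: dist_real_def)
qed

text \<open>Points of \<open>linf\<close> are extensional, hence the restricted abstraction;
  boundedness is inherited because the section takes only values of \<open>x\<close>.\<close>

lemma section_linf:
  assumes "x \<in> mspace (linf (\<Theta> \<times> \<F>))" "\<theta> \<in> \<Theta>"
  shows "(\<lambda>f\<in>\<F>. x (\<theta>, f)) \<in> mspace (linf \<F>)"
proof -
  have "(\<lambda>f\<in>\<F>. x (\<theta>, f)) ` \<F> \<subseteq> x ` (\<Theta> \<times> \<F>)"
    using assms(2) by auto
  then show ?thesis
    using assms(1) bounded_subset unfolding mspace_linf by blast
qed

text \<open>Fixing \<theta> means taking the supremum over the smaller index set {\<theta>} \<times>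
  \<F>.\<close>

lemma mdist_section_linf_le:
  assumes x: "x \<in> mspace (linf (\<Theta> \<times> \<F>))" and y: "y \<in> mspace (linf (\<Theta> \<times> \<F>))"
    and \<theta>: "\<theta> \<in> \<Theta>"
  shows "mdist (linf \<F>) (\<lambda>f\<in>\<F>. x (\<theta>, f)) (\<lambda>f\<in>\<F>. y (\<theta>, f)) \<le> mdist (linf (\<Theta> \<times> \<F>)) x y"
\<comment> \<open>Suprema of reals need a non-empty index set; for empty \<F> the two sections are
  the same function.\<close>
proof (cases "\<F> = {}")
  case False
  note sec = section_linf[OF x \<theta>] section_linf[OF y \<theta>]
  have "(SUP f\<in>\<F>. dist ((\<lambda>f\<in>\<F>. x (\<theta>, f)) f) ((\<lambda>f\<in>\<F>. y (\<theta>, f)) f)) \<le>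
      (SUP i\<in>\<Theta> \<times> \<F>. dist (x i) (y i))"
  proof (rule cSUP_least[OF False])
    fix f assume f: "f \<in> \<F>"
    then have "dist ((\<lambda>f\<in>\<F>. x (\<theta>, f)) f) ((\<lambda>f\<in>\<F>. y (\<theta>, f)) f) = dist (x (\<theta>, f)) (y (\<theta>, f))"
      by simp
    also have "\<dots> \<le> (SUP i\<in>\<Theta> \<times> \<F>. dist (x i) (y i))"
      by (rule cSUP_upper[OF _ bdd_above_dist_linf[OF x y]]) (use f \<theta> in simp)
    finally show "dist ((\<lambda>f\<in>\<F>. x (\<theta>, f)) f) ((\<lambda>f\<in>\<F>. y (\<theta>, f)) f) \<le>
      (SUP i\<in>\<Theta> \<times> \<F>. dist (x i) (y i))" .
  qed
  then show ?thesis
    using x y sec False \<theta> by (auto simp: Met_TC.fdist_def)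
qed simp

lemma continuous_map_section_linf:
  assumes "\<theta> \<in> \<Theta>"
  shows "continuous_map (mtopology_of (linf (\<Theta> \<times> \<F>))) (mtopology_of (linf \<F>)) (\<lambda>x. \<lambda>f\<in>\<F>. x (\<theta>, f))"
proof (rule Lipschitz_continuous_imp_continuous_map)
  show "Lipschitz_continuous_map (linf (\<Theta> \<times> \<F>)) (linf \<F>) (\<lambda>x. \<lambda>f\<in>\<F>. x (\<theta>, f))"
    unfolding Lipschitz_continuous_map_def
    using section_linf[OF _ assms] mdist_section_linf_le[OF _ _ assms]
    by (intro conjI funcsetI exI[of _ 1] ballI) (simp_all only: mult_1)
qed

section \<open>Covariance, normality and path continuity of a section\<close>

text \<open>Boundedness makes \<open>f\<close>, \<open>g\<close> and their product integrable, so
  the centred product can be expanded; a change of variables along \<open>X\<close> then gives the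
  Brownian bridge covariance.\<close>

lemma (in prob_space) covariance_distributed_eq:
  fixes f g :: "real \<Rightarrow> real"
  assumes X: "distributed M N X p"
    and f: "f \<in> borel_measurable N" "bounded (f ` space N)"
    and g: "g \<in> borel_measurable N" "bounded (g ` space N)"
  shows "(\<integral>v. (f (X v) - (\<integral>u. f (X u) \<partial>M)) * (g (X v) - (\<integral>u. g (X u) \<partial>M)) \<partial>M) =
    (\<integral>x. f x * g x \<partial>density N p) - (\<integral>x. f x \<partial>density N p) * (\<integral>x. g x \<partial>density N p)"
proof -
  have Xm: "X \<in> measurable M N" and d: "distr M N X = density N p"
    using X by (auto simp: distributed_def)
  have int: "integrable M (\<lambda>v. h (X v))"
    if "h \<in> borel_measurable N" "bounded (h ` space N)" for h :: "real \<Rightarrow> real"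
  proof -
    obtain B where "\<forall>x\<in>space N. norm (h x) \<le> B"
      using \<open>bounded (h ` space N)\<close> by (auto simp: bounded_iff)
    then show ?thesis
      by (intro integrable_const_bound[where B = B] AE_I2 measurable_compose[OF Xm that(1)])
        (use measurable_space[OF Xm] in blast)
  qed
  have E: "(\<integral>v. h (X v) \<partial>M) = (\<integral>x. h x \<partial>density N p)"
    if "h \<in> borel_measurable N" for h :: "real \<Rightarrow> real"
    unfolding d[symmetric] using that by (simp add: integral_distr[OF Xm])
  obtain A B where A: "\<forall>x\<in>space N. norm (f x) \<le> A" and B: "\<forall>x\<in>space N. norm (g x) \<le> B"
    using f(2) g(2) by (auto simp: bounded_iff)
  have "norm (f x * g x) \<le> A * B" if "x \<in> space N" for x
    unfolding norm_mult using A B that by (intro mult_mono) (auto intro: order.trans[OF norm_ge_zero])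
  then have "bounded ((\<lambda>x. f x * g x) ` space N)"
    by (intro boundedI[of _ "A * B"]) auto
  then have fg: "integrable M (\<lambda>v. f (X v) * g (X v))"
    by (intro int) (use f g in auto)
  define a where "a = (\<integral>u. f (X u) \<partial>M)"
  define b where "b = (\<integral>u. g (X u) \<partial>M)"
  have "(\<integral>v. (f (X v) - a) * (g (X v) - b) \<partial>M) =
      (\<integral>v. f (X v) * g (X v) - b * f (X v) - a * g (X v) + a * b \<partial>M)"
    by (rule Bochner_Integration.integral_cong) (auto simp: algebra_simps)
  also have "\<dots> = (\<integral>v. f (X v) * g (X v) \<partial>M) - b * a - a * b + a * b"
    using fg int[OF f] int[OF g] by (simp add: prob_space a_def b_def)
  finally show ?thesis
    unfolding a_def b_def using E[of "\<lambda>x. f x * g x"] E[OF f(1)] E[OF g(1)] f(1) g(1) by simp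
qed

lemma gaussian_process_section:
  assumes "gaussian_process M (\<Theta> \<times> \<F>) X" "\<theta> \<in> \<Theta>"
  shows "gaussian_process M \<F> (\<lambda>w. \<lambda>f\<in>\<F>. X w (\<theta>, f))"
  unfolding gaussian_process_def
proof (intro allI impI)
  fix J c assume J: "finite J \<and> J \<subseteq> \<F>"
  \<comment> \<open>The map \<open>Pair \<theta>\<close> is injective, so a combination over
    \<open>J\<close> is one over its image, with the coefficients read off the second
    component.\<close>
  have "normal_rv M (\<lambda>w. \<Sum>j\<in>Pair \<theta> ` J. (c \<circ> snd) j * X w j)"
    using assms J unfolding gaussian_process_def by blast
  also have "(\<lambda>w. \<Sum>j\<in>Pair \<theta> ` J. (c \<circ> snd) j * X w j) =
      (\<lambda>w. \<Sum>j\<in>J. c j * (\<lambda>f\<in>\<F>. X w (\<theta>, f)) j)"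
    using J by (auto simp: sum.reindex inj_on_def intro!: ext sum.cong)
  finally show "normal_rv M (\<lambda>w. \<Sum>j\<in>J. c j * (\<lambda>f\<in>\<F>. X w (\<theta>, f)) j)" .
qed

text \<open>The standard-deviation metric of the section is the restriction of that of the full
  process, so the same \<delta> works.\<close>

lemma sd_uniformly_continuous_paths_section:
  assumes "sd_uniformly_continuous_paths M (\<Theta> \<times> \<F>) X" "\<theta> \<in> \<Theta>"
  shows "sd_uniformly_continuous_paths M \<F> (\<lambda>w. \<lambda>f\<in>\<F>. X w (\<theta>, f))"
  unfolding sd_uniformly_continuous_paths_def
proof (intro ballI allI impI)
  fix w and \<epsilon> :: real assume "w \<in> space M" "\<epsilon> > 0"
  then obtain \<delta> where \<delta>: "\<delta> > 0" "\<And>i j. i \<in> \<Theta> \<times> \<F> \<Longrightarrow> j \<in> \<Theta> \<times> \<F> \<Longrightarrow>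
      sd_metric M X i j < \<delta> \<Longrightarrow> \<bar>X w i - X w j\<bar> < \<epsilon>"
    using assms(1) unfolding sd_uniformly_continuous_paths_def by metis
  have "sd_metric M (\<lambda>w. \<lambda>f\<in>\<F>. X w (\<theta>, f)) f g = sd_metric M X (\<theta>, f) (\<theta>, g)"
    if "f \<in> \<F>" "g \<in> \<F>" for f g
    using that by (simp add: sd_metric_def)
  then show "\<exists>\<delta>>0. \<forall>i\<in>\<F>. \<forall>j\<in>\<F>. sd_metric M (\<lambda>w. \<lambda>f\<in>\<F>. X w (\<theta>, f)) i j < \<delta> \<longrightarrow>
      \<bar>(\<lambda>f\<in>\<F>. X w (\<theta>, f)) i - (\<lambda>f\<in>\<F>. X w (\<theta>, f)) j\<bar> < \<epsilon>"
    using \<delta> assms(2) by (intro exI[of _ \<delta>]) auto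
qed

section \<open>Bounded Lipschitz distances of all sections at once\<close>

lemma SUP_BL_dist_section_tendsto_0:
  assumes wc: "weakly_converges (linf (\<Theta> \<times> \<F>)) P Y Q Z"
    and sep: "separable_range Q (linf (\<Theta> \<times> \<F>)) Z"
    and P: "prob_space P" and Q: "prob_space Q" and "\<Theta> \<noteq> {}"
  shows "(\<lambda>k. SUP \<theta>\<in>\<Theta>. BL_dist (linf \<F>) P (\<lambda>\<omega>. \<lambda>f\<in>\<F>. Y k \<omega> (\<theta>, f)) Q (\<lambda>w. \<lambda>f\<in>\<F>. Z w (\<theta>, f)))
    \<longlonglongrightarrow> 0"
proof (rule tendstoI)
  fix e :: real assume "e > 0"
  define \<Delta> where "\<Delta> k \<theta> h = \<bar>outer_integral P (\<lambda>\<omega>. h (\<lambda>f\<in>\<F>. Y k \<omega> (\<theta>, f))) -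
    (\<integral>w. h (\<lambda>f\<in>\<F>. Z w (\<theta>, f)) \<partial>Q)\<bar>" for k \<theta> h
  let ?B = "\<lambda>k \<theta>. BL_dist (linf \<F>) P (\<lambda>\<omega>. \<lambda>f\<in>\<F>. Y k \<omega> (\<theta>, f)) Q (\<lambda>w. \<lambda>f\<in>\<F>. Z w (\<theta>, f))"
  \<comment> \<open>Suprema preserve only non-strict bounds; \<open>e / 2\<close> leaves room for
    the strict inequality at the end.\<close>
  have "\<forall>\<^sub>F k in sequentially. \<forall>h\<in>BL_unit_ball (linf (\<Theta> \<times> \<F>)).
      \<bar>outer_integral P (\<lambda>\<omega>. h (Y k \<omega>)) - (\<integral>w. h (Z w) \<partial>Q)\<bar> \<le> e / 2"
    by (rule weakly_converges_imp_uniform_BL[OF wc sep P Q]) (use \<open>e > 0\<close> in simp)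
  then show "\<forall>\<^sub>F k in sequentially. dist (SUP \<theta>\<in>\<Theta>. ?B k \<theta>) 0 < e"
  proof eventually_elim
    case (elim k)
    have \<Delta>: "\<Delta> k \<theta> h \<le> e / 2" if "\<theta> \<in> \<Theta>" "BL_norm (linf \<F>) h \<le> 1" for \<theta> h
    proof -
      have "(\<lambda>x. h (\<lambda>f\<in>\<F>. x (\<theta>, f))) \<in> BL_unit_ball (linf (\<Theta> \<times> \<F>))"
        by (rule BL_unit_ball_comp[OF BL_norm_le_1_imp_BL_unit_ball[OF that(2)]
              funcsetI[OF section_linf[OF _ that(1)]] mdist_section_linf_le[OF _ _ that(1)]])
      then show ?thesis
        using elim by (auto simp: \<Delta>_def)
    qed
    have zero: "BL_norm (linf \<F>) (\<lambda>_. 0) \<le> 1"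
      by (simp only: BL_norm_zero zero_le_one)
    have B: "0 \<le> ?B k \<theta>" "?B k \<theta> \<le> e / 2" if "\<theta> \<in> \<Theta>" for \<theta>
    proof -
      have eq: "?B k \<theta> = (SUP h\<in>{h. BL_norm (linf \<F>) h \<le> 1}. \<Delta> k \<theta> h)"
        by (simp only: BL_dist_def \<Delta>_def)
      show "?B k \<theta> \<le> e / 2"
        unfolding eq using zero \<Delta>[OF that] by (intro cSUP_least) blast+
      have "bdd_above (\<Delta> k \<theta> ` {h. BL_norm (linf \<F>) h \<le> 1})"
        using \<Delta>[OF that] by (intro bdd_aboveI[of _ "e / 2"]) blast
      then have "\<Delta> k \<theta> (\<lambda>_. 0) \<le> ?B k \<theta>"
        unfolding eq using zero by (intro cSUP_upper) blast+
      then show "0 \<le> ?B k \<theta>"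
        unfolding \<Delta>_def by (rule order.trans[OF abs_ge_zero])
    qed
    \<comment> \<open>One index \<theta>0 with a nonnegative distance bounds the supremum over
      \<Theta> from below by 0.\<close>
    obtain \<theta>0 where \<theta>0: "\<theta>0 \<in> \<Theta>" using \<open>\<Theta> \<noteq> {}\<close> by blast
    have "bdd_above (?B k ` \<Theta>)"
      using B(2) by (intro bdd_aboveI[of _ "e / 2"]) blast
    then have "?B k \<theta>0 \<le> (SUP \<theta>\<in>\<Theta>. ?B k \<theta>)"
      by (rule cSUP_upper[OF \<theta>0])
    moreover have "(SUP \<theta>\<in>\<Theta>. ?B k \<theta>) \<le> e / 2"
      by (rule cSUP_least[OF \<open>\<Theta> \<noteq> {}\<close> B(2)])
    ultimately show ?case
      using B(1)[OF \<theta>0] \<open>e > 0\<close> unfolding dist_real_def by linarith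
  qed
qed


section \<open>The uniform limit theorem and the Brownian bridge\<close>

theorem corollary16:
  fixes \<Omega> :: "real set" and t \<zeta> D s \<gamma> a :: real
    and \<Theta> :: "(real ^ 'm) set"
    and p :: "real ^ 'm \<Rightarrow> real \<Rightarrow> real"
    and \<mu> :: "'v measure" and \<rho> :: "'v \<Rightarrow> real ^ 'm \<Rightarrow> real" and R :: "'v \<Rightarrow> real"
    and \<F> :: "(real \<Rightarrow> real) set"
    and Q :: "'w measure" and G :: "'w \<Rightarrow> (real ^ 'm) \<times> (real \<Rightarrow> real) \<Rightarrow> real"
  assumes Omega: "\<Omega> \<noteq> {}" "open \<Omega>" "is_interval \<Omega>" "bounded \<Omega>"
    and params: "t > 1/2" "0 \<le> \<zeta>" "\<zeta> < 1 / measure lborel \<Omega>" "1 / measure lborel \<Omega> < D\<^sup>2"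
    and Theta: "\<Theta> \<noteq> {}" "compact \<Theta>"
    and V: "prob_space \<mu>"
    and rho: "\<And>\<theta>. \<theta> \<in> \<Theta> \<Longrightarrow>
      distributed \<mu> (lborel_on \<Omega>) (\<lambda>v. \<rho> v \<theta>) (\<lambda>x. ennreal (p \<theta> x))"
    and p_in: "\<And>\<theta>. \<theta> \<in> \<Theta> \<Longrightarrow> p \<theta> \<in> sobolev_densities \<Omega> t \<zeta> D"
    and p_inf: "(INF (x, \<theta>)\<in>\<Omega> \<times> \<Theta>. p \<theta> x) > \<zeta>"
    and p_norm: "(SUP \<theta>\<in>\<Theta>. sobolev_norm \<Omega> t (p \<theta>)) < D"
    and gamma: "0 < \<gamma>" "\<gamma> \<le> 1"
    and R: "R \<in> borel_measurable \<mu>" "\<And>v. v \<in> space \<mu> \<Longrightarrow> R v > 0"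
    and R_moment: "a > 0" "integrable \<mu> (\<lambda>v. R v powr a)"
    and rho_Hoelder: "\<And>v \<theta> \<theta>'. v \<in> space \<mu> \<Longrightarrow> \<theta> \<in> \<Theta> \<Longrightarrow> \<theta>' \<in> \<Theta> \<Longrightarrow>
      \<bar>\<rho> v \<theta>' - \<rho> v \<theta>\<bar> \<le> R v * norm (\<theta>' - \<theta>) powr \<gamma>"
    and F: "s > 1/2" "\<F> \<noteq> {}" "\<F> \<subseteq> sobolev_space \<Omega> s" "\<exists>B. \<forall>f\<in>\<F>. sobolev_norm \<Omega> s f \<le> B"
    and Q: "prob_space Q"
    and G_measurable: "G \<in> measurable Q (borel_of_metric (linf (\<Theta> \<times> \<F>)))"
    and G_separable: "separable_range Q (linf (\<Theta> \<times> \<F>)) G"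
    and G_gaussian: "gaussian_process Q (\<Theta> \<times> \<F>) G" "mean_zero Q (\<Theta> \<times> \<F>) G"
    and G_paths: "sd_uniformly_continuous_paths Q (\<Theta> \<times> \<F>) G"
    and G_cov: "\<And>\<theta> \<theta>' f g. \<theta> \<in> \<Theta> \<Longrightarrow> \<theta>' \<in> \<Theta> \<Longrightarrow> f \<in> \<F> \<Longrightarrow> g \<in> \<F> \<Longrightarrow>
      covariance Q (\<lambda>w. G w (\<theta>, f)) (\<lambda>w. G w (\<theta>', g)) =
      (\<integral>v. (f (\<rho> v \<theta>) - (\<integral>u. f (\<rho> u \<theta>) \<partial>\<mu>)) * (g (\<rho> v \<theta>') - (\<integral>u. g (\<rho> u \<theta>') \<partial>\<mu>)) \<partial>\<mu>)"
    and G_limit: "weakly_converges (linf (\<Theta> \<times> \<F>))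
      (PiM UNIV (\<lambda>_::nat. \<mu>)) (\<lambda>k \<omega>. \<lambda>(\<theta>, f)\<in>\<Theta> \<times> \<F>. npml_process \<Omega> t \<zeta> D \<rho> p k \<omega> \<theta> f) Q G"
  shows "(\<forall>\<theta>\<in>\<Theta>. (\<lambda>w. \<lambda>f\<in>\<F>. G w (\<theta>, f)) \<in> measurable Q (borel_of_metric (linf \<F>)) \<and>
        separable_range Q (linf \<F>) (\<lambda>w. \<lambda>f\<in>\<F>. G w (\<theta>, f))) \<and>
      (\<lambda>k. SUP \<theta>\<in>\<Theta>. BL_dist (linf \<F>)
        (PiM UNIV (\<lambda>_::nat. \<mu>)) (\<lambda>\<omega>. \<lambda>f\<in>\<F>. npml_process \<Omega> t \<zeta> D \<rho> p k \<omega> \<theta> f)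
        Q (\<lambda>w. \<lambda>f\<in>\<F>. G w (\<theta>, f))) \<longlonglongrightarrow> 0 \<and>
      (\<forall>\<theta>\<in>\<Theta>. brownian_bridge Q (density (lborel_on \<Omega>) (\<lambda>x. ennreal (p \<theta> x))) \<F>
        (\<lambda>w. \<lambda>f\<in>\<F>. G w (\<theta>, f)))"
proof (intro conjI ballI)
  fix \<theta> assume \<theta>: "\<theta> \<in> \<Theta>"
  note cont = continuous_map_section_linf[OF \<theta>, of \<F>]
  show meas: "(\<lambda>w. \<lambda>f\<in>\<F>. G w (\<theta>, f)) \<in> measurable Q (borel_of_metric (linf \<F>))"
    using measurable_compose[OF G_measurable measurable_borel_of_metric_continuous_map[OF cont]] .
  have "G \<in> space Q \<rightarrow> mspace (linf (\<Theta> \<times> \<F>))"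
    using measurable_space[OF G_measurable] by (simp only: space_borel_of_metric funcsetI)
  then show "separable_range Q (linf \<F>) (\<lambda>w. \<lambda>f\<in>\<F>. G w (\<theta>, f))"
    by (rule separable_range_comp[OF G_separable cont])
  \<comment> \<open>Members of the Sobolev space are continuous and bounded on \<Omega>, as the
    covariance formula demands; \<open>borel\<close> and \<open>lborel\<close> restrict to the same
    sets.\<close>
  have bounded_measurable:
    "f \<in> borel_measurable (lborel_on \<Omega>) \<and> bounded (f ` space (lborel_on \<Omega>))" if "f \<in> \<F>" for f
  proof -
    have "f \<in> borel_measurable (restrict_space borel \<Omega>)" "bounded (f ` \<Omega>)"
      using F(3) that by (auto simp: sobolev_space_def intro!: borel_measurable_continuous_on_restrict)
    moreover have "sets (restrict_space borel \<Omega>) = sets (lborel_on \<Omega>)"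
      by (rule sets_restrict_space_cong) simp
    ultimately show ?thesis
      by (simp add: space_restrict_space cong: measurable_cong_sets)
  qed
  \<comment> \<open>The covariance of \<open>G\<close> at equal parameters is an integral over
    \<mu>; \<open>rho\<close> gives the law of the observation at \<theta>, which turns it into
    integrals against the density.\<close>
  have cov: "covariance Q (\<lambda>w. (\<lambda>f\<in>\<F>. G w (\<theta>, f)) f) (\<lambda>w. (\<lambda>f\<in>\<F>. G w (\<theta>, f)) g) =
      (\<integral>x. f x * g x \<partial>density (lborel_on \<Omega>) (\<lambda>x. ennreal (p \<theta> x))) -
      (\<integral>x. f x \<partial>density (lborel_on \<Omega>) (\<lambda>x. ennreal (p \<theta> x))) *
      (\<integral>x. g x \<partial>density (lborel_on \<Omega>) (\<lambda>x. ennreal (p \<theta> x)))"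
    if "f \<in> \<F>" "g \<in> \<F>" for f g
    using G_cov[OF \<theta> \<theta> that] prob_space.covariance_distributed_eq[OF V rho[OF \<theta>]]
      bounded_measurable[OF that(1)] bounded_measurable[OF that(2)] that by simp
  have "mean_zero Q \<F> (\<lambda>w. \<lambda>f\<in>\<F>. G w (\<theta>, f))"
    using G_gaussian(2) \<theta> by (simp add: mean_zero_def)
  then show "brownian_bridge Q (density (lborel_on \<Omega>) (\<lambda>x. ennreal (p \<theta> x))) \<F>
      (\<lambda>w. \<lambda>f\<in>\<F>. G w (\<theta>, f))"
    unfolding brownian_bridge_def
    using gaussian_process_section[OF G_gaussian(1) \<theta>] meas cov
      sd_uniformly_continuous_paths_section[OF G_paths \<theta>] by blast
next
  have "prob_space (PiM UNIV (\<lambda>_::nat. \<mu>))"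
    by (rule prob_space_PiM[OF V])
  from SUP_BL_dist_section_tendsto_0[OF G_limit G_separable this Q Theta(1)]
  \<comment> \<open>For \<theta> in \<Theta> the section of the process restricted to \<Theta>
    \<times> \<F> is the process restricted to \<F>; the congruence rules supply these
    memberships.\<close>
  show "(\<lambda>k. SUP \<theta>\<in>\<Theta>. BL_dist (linf \<F>)
      (PiM UNIV (\<lambda>_::nat. \<mu>)) (\<lambda>\<omega>. \<lambda>f\<in>\<F>. npml_process \<Omega> t \<zeta> D \<rho> p k \<omega> \<theta> f)
      Q (\<lambda>w. \<lambda>f\<in>\<F>. G w (\<theta>, f))) \<longlonglongrightarrow> 0"
    by (simp cong: SUP_cong restrict_cong)
qed

end
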